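(* Let $\beta\in\mathbb R$, $\gamma>0$, and let $\mathbf U^0,\mathbf U^1,\dots,\mathbf U^M\in\mathbb V_h$ be a solution of the LI-CFP scheme consisting of $$\mathrm i\delta_t\mathbf U^n+\mathbf\Delta_h\widehat{\mathbf U}^n+\beta e^{-2\gamma t_n}|\mathbf U^n|^2\cdot\widehat{\mathbf U}^n=0,\quad n=1,\dots,M-1,$$ and of the first step $$\mathrm i\delta_t^+\mathbf U^0+\mathbf\Delta_h\mathbf U^{\frac12}+\beta e^{-2\gamma t_{1/2}}|\mathbf U^{(\frac12)}|^2\cdot\mathbf U^{\frac12}=0.$$ Then the scheme possesses the discrete total mass conservation law $$\mathcal M^n=\mathcal M^0,\qquad \mathcal M^n:=\|\mathbf U^n\|_h^2,\qquad n=1,2,\dots,M.$$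
   Context: Grid: $\Omega=[0,l_1]\times[0,l_2]\times[0,l_3]$; $N_1,N_2,N_3$ are even positive integers, $h_r=l_r/N_r$, $J_h=\{\vec j=(j_1,j_2,j_3):0\le j_r\le N_r-1,\ r=1,2,3\}$, grid points $\mathbf x_{\vec j}=(x_{j_1},y_{j_2},z_{j_3})=(j_1h_1,j_2h_2,j_3h_3)$. $\mathbb V_h$ is the space of complex grid functions $\mathbf U=(U_{\vec j})_{\vec j\in J_h}$, extended periodically with period $N_r$ in the index $j_r$. With $h_\Delta=h_1h_2h_3$: $\langle\mathbf U,\mathbf V\rangle_h=h_\Delta\sum_{\vec j\in J_h}U_{\vec j}\overline{V_{\vec j}}$, $\|\mathbf U\|_h^2=\langle\mathbf U,\mathbf U\rangle_h$. The dot $\cdot$ between grid functions is the componentwise product and $|\mathbf U|^2=\mathbf U\cdot\bar{\mathbf U}$. Fourier pseudo-spectral Laplacian: for $r=1,2,3$ let $\mu_r=2\pi/l_r$, let $w^{(r)}_j=jh_r$, let $g^{(r)}_j(w)=\frac1{N_r}\sum_{l=-N_r/2}^{N_r/2}\frac1{a_l}e^{\mathrm il\mu_r(w-w^{(r)}_j)}$ with $a_l=1$ for $|l|<N_r/2$ and $a_l=2$ for $|l|=N_r/2$, and let $\mathbf D^{(r)}$ be the real symmetric $N_r\times N_r$ matrix with entries $(\mathbf D^{(r)})_{k,j}=\frac{d^2g^{(r)}_j}{dw^2}(w^{(r)}_k)$, $0\le k,j\le N_r-1$. Then $$(\mathbf\Delta_h\mathbf U)_{\vec j}=\sum_{j=0}^{N_1-1}(\mathbf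 D^{(1)})_{j_1,j}U_{j,j_2,j_3}+\sum_{k=0}^{N_2-1}(\mathbf D^{(2)})_{j_2,k}U_{j_1,k,j_3}+\sum_{m=0}^{N_3-1}(\mathbf D^{(3)})_{j_3,m}U_{j_1,j_2,m}.$$ Time discretization: $T>0$, $M$ a positive integer, $\tau=T/M$, $t_n=n\tau$, $t_{1/2}=\tau/2$; $\delta_t\mathbf U^n=\frac{\mathbf U^{n+1}-\mathbf U^{n-1}}{2\tau}$, $\delta_t^+\mathbf U^n=\frac{\mathbf U^{n+1}-\mathbf U^n}\tau$, $\widehat{\mathbf U}^n=\frac{\mathbf U^{n+1}+\mathbf U^{n-1}}2$, $\mathbf U^{n+\frac12}=\frac{\mathbf U^{n+1}+\mathbf U^n}2$. Initial data: $\psi_0$ is a given $(l_1,l_2,l_3)$-periodic complex-valued function (regular enough that $\Delta\psi_0(\mathbf x_{\vec j})$ is defined), $U^0_{\vec j}=\psi_0(\mathbf x_{\vec j})$, and $$U^{(\frac12)}_{\vec j}=\psi_0(\mathbf x_{\vec j})+\frac\tau2\mathrm i\Big(\Delta\psi_0(\mathbf x_{\vec j})+\beta|\psi_0(\mathbf x_{\vec j})|^2\psi_0(\mathbf x_{\vec j})\Big).$$ *)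

theory Defs
  imports "HOL-Analysis.Analysis"
begin

text \<open>
  The box has side lengths \<open>l $ r\<close> and \<open>N $ r\<close> grid cells in direction \<open>r\<close>. Grid functions are
  indexed by all integer triples; periodicity is the membership condition of \<open>grid_space\<close>.
\<close>

type_synonym grid_fun = "int ^ 3 \<Rightarrow> complex"

definition mesh :: "real ^ 3 \<Rightarrow> nat ^ 3 \<Rightarrow> 3 \<Rightarrow> real" where
  "mesh l N r = l $ r / real (N $ r)"

definition mesh_vol :: "real ^ 3 \<Rightarrow> nat ^ 3 \<Rightarrow> real" where
  "mesh_vol l N = mesh l N 1 * mesh l N 2 * mesh l N 3"

definition grid_index :: "nat ^ 3 \<Rightarrow> (int ^ 3) set" where
  "grid_index N = {j. \<forall>r. 0 \<le> j $ r \<and> j $ r \<le> int (N $ r) - 1}"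

definition grid_point :: "real ^ 3 \<Rightarrow> nat ^ 3 \<Rightarrow> int ^ 3 \<Rightarrow> real ^ 3" where
  "grid_point l N j = (\<chi> r. of_int (j $ r) * mesh l N r)"

definition set_index :: "int ^ 3 \<Rightarrow> 3 \<Rightarrow> int \<Rightarrow> int ^ 3" where
  "set_index j r k = (\<chi> s. if s = r then k else j $ s)"

definition grid_space :: "nat ^ 3 \<Rightarrow> grid_fun set" where
  "grid_space N = {U. \<forall>j r. U (set_index j r (j $ r + int (N $ r))) = U j}"

definition inner_h :: "real ^ 3 \<Rightarrow> nat ^ 3 \<Rightarrow> grid_fun \<Rightarrow> grid_fun \<Rightarrow> complex" where
  "inner_h l N U V = of_real (mesh_vol l N) * (\<Sum>j\<in>grid_index N. U j * cnj (V j))"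

definition norm_h :: "real ^ 3 \<Rightarrow> nat ^ 3 \<Rightarrow> grid_fun \<Rightarrow> real" where
  "norm_h l N U = sqrt (Re (inner_h l N U U))"

definition mass_h :: "real ^ 3 \<Rightarrow> nat ^ 3 \<Rightarrow> grid_fun \<Rightarrow> real" where
  "mass_h l N U = (norm_h l N U)\<^sup>2"

text \<open>
  One-dimensional trigonometric interpolation on \<open>[0, L]\<close> with \<open>n\<close> (even) nodes \<open>j * (L / n)\<close>.
  The differentiation matrix is given by its defining second derivative; it is complex-typed
  because the basis functions are written with complex exponentials.
\<close>

definition end_weight :: "nat \<Rightarrow> int \<Rightarrow> complex" where
  "end_weight n p = (if 2 * \<bar>p\<bar> = int n then 2 else 1)"

definition trig_basis :: "real \<Rightarrow> nat \<Rightarrow> int \<Rightarrow> real \<Rightarrow> complex" where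
  "trig_basis L n j w =
     1 / of_nat n * (\<Sum>p = - (int n div 2)..int n div 2.
       1 / end_weight n p *
       exp (\<i> * of_int p * of_real ((2 * pi / L) * (w - of_int j * (L / real n)))))"

definition diff2_matrix :: "real \<Rightarrow> nat \<Rightarrow> int \<Rightarrow> int \<Rightarrow> complex" where
  "diff2_matrix L n k j =
     vector_derivative (\<lambda>w. vector_derivative (trig_basis L n j) (at w)) (at (of_int k * (L / real n)))"

definition laplacian_h :: "real ^ 3 \<Rightarrow> nat ^ 3 \<Rightarrow> grid_fun \<Rightarrow> grid_fun" where
  "laplacian_h l N U j =
     (\<Sum>r\<in>UNIV. \<Sum>k = 0..int (N $ r) - 1.
        diff2_matrix (l $ r) (N $ r) (j $ r) k * U (set_index j r k))"

text \<open>
  The time-difference and averaging operators act on sequences of grid functions. At \<open>n = 0\<close> the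
  expression \<open>n - 1\<close> is truncated, so \<open>dt_central\<close> and \<open>avg_hat\<close> are meant for \<open>n \<ge> 1\<close> only.
\<close>

definition dt_central :: "real \<Rightarrow> (nat \<Rightarrow> grid_fun) \<Rightarrow> nat \<Rightarrow> grid_fun" where
  "dt_central \<tau> U n j = (U (n + 1) j - U (n - 1) j) / of_real (2 * \<tau>)"

definition dt_forward :: "real \<Rightarrow> (nat \<Rightarrow> grid_fun) \<Rightarrow> nat \<Rightarrow> grid_fun" where
  "dt_forward \<tau> U n j = (U (n + 1) j - U n j) / of_real \<tau>"

definition avg_hat :: "(nat \<Rightarrow> grid_fun) \<Rightarrow> nat \<Rightarrow> grid_fun" where
  "avg_hat U n j = (U (n + 1) j + U (n - 1) j) / 2"

definition avg_half :: "(nat \<Rightarrow> grid_fun) \<Rightarrow> nat \<Rightarrow> grid_fun" where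
  "avg_half U n j = (U (n + 1) j + U n j) / 2"

definition partial_deriv :: "3 \<Rightarrow> (real ^ 3 \<Rightarrow> complex) \<Rightarrow> real ^ 3 \<Rightarrow> complex" where
  "partial_deriv r f x = vector_derivative (\<lambda>s. f (x + s *\<^sub>R axis r 1)) (at 0)"

definition laplacian :: "(real ^ 3 \<Rightarrow> complex) \<Rightarrow> real ^ 3 \<Rightarrow> complex" where
  "laplacian f x = (\<Sum>r\<in>UNIV. partial_deriv r (partial_deriv r f) x)"

text \<open>All unmixed second partial derivatives of \<open>f\<close> exist at \<open>x\<close>.\<close>

definition laplacian_exists_at :: "(real ^ 3 \<Rightarrow> complex) \<Rightarrow> real ^ 3 \<Rightarrow> bool" where
  "laplacian_exists_at f x \<longleftrightarrow> (\<forall>r.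
     (\<forall>\<^sub>F t in nhds 0. (\<lambda>s. f (x + s *\<^sub>R axis r 1)) differentiable (at t)) \<and>
     (\<lambda>s. partial_deriv r f (x + s *\<^sub>R axis r 1)) differentiable (at 0))"

definition box_periodic :: "real ^ 3 \<Rightarrow> (real ^ 3 \<Rightarrow> complex) \<Rightarrow> bool" where
  "box_periodic l f \<longleftrightarrow> (\<forall>x r. f (x + (l $ r) *\<^sub>R axis r 1) = f x)"

definition half_step_data ::
  "real ^ 3 \<Rightarrow> nat ^ 3 \<Rightarrow> real \<Rightarrow> real \<Rightarrow> (real ^ 3 \<Rightarrow> complex) \<Rightarrow> grid_fun" where
  "half_step_data l N \<beta> \<tau> \<psi>0 j =
     (let x = grid_point l N j in
      \<psi>0 x + of_real (\<tau> / 2) * \<i> *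
        (laplacian \<psi>0 x + of_real \<beta> * of_real ((cmod (\<psi>0 x))\<^sup>2) * \<psi>0 x))"

end

theory Submission
  imports Defs
begin

text \<open>
  Every step of the scheme, the starting one included, is a Crank--Nicolson step: two grid
  functions \<open>V\<close> (new) and \<open>W\<close> (old) with average \<open>A = (V + W) / 2\<close> satisfy
  \<open>\<i> * (V - W) / c + \<Delta>\<^sub>h A + q * A = 0\<close> on the grid, where the potential \<open>q\<close> is real, being
  a real multiple of a squared modulus. Pair this identity with \<open>A\<close> and take imaginary
  parts. The potential contributes \<open>q * \<bar>A\<bar>\<^sup>2\<close>, which is real, and \<open>\<Delta>\<^sub>h\<close> contributes its quadratic
  form, which is real because the differentiation matrices are Hermitian
  (\<open>laplacian_h_quadratic_form_real\<close>). What remains is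
  \<open>Re ((V - W) * cnj (V + W)) = \<bar>V\<bar>\<^sup>2 - \<bar>W\<bar>\<^sup>2\<close>, whose sum over the grid must therefore vanish: the
  step preserves the mass (\<open>crank_nicolson_step_mass\<close>).

  The leapfrog steps link only time levels of equal parity, so on their own they would allow two
  different masses, one for even and one for odd levels. The starting step, which links levels 0
  and 1, is what identifies the two.
\<close>

lemma trig_sum_has_vector_derivative:
  fixes c a :: "'i \<Rightarrow> complex" and m x :: real
  shows "((\<lambda>w. \<Sum>p\<in>S. c p * exp (a p * of_real (m * (w - x)))) has_vector_derivative
           (\<Sum>p\<in>S. (c p * (a p * of_real m)) * exp (a p * of_real (m * (w - x))))) (at w)"
proof -
  have "((\<lambda>z. \<Sum>p\<in>S. c p * exp (a p * (of_real m * (z - of_real x)))) has_field_derivative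
           (\<Sum>p\<in>S. (c p * (a p * of_real m)) * exp (a p * (of_real m * (of_real w - of_real x)))))
           (at (of_real w))"
    by (rule DERIV_sum) (auto intro!: derivative_eq_intros)
  from has_vector_derivative_real_field[OF this, of UNIV] show ?thesis
    by simp
qed

lemma diff2_matrix_eq:
  "diff2_matrix L n k j =
     (\<Sum>p = - (int n div 2)..int n div 2.
        - of_real ((of_int p * (2 * pi / L))\<^sup>2) / (of_nat n * end_weight n p) *
        exp (\<i> * of_int p *
          of_real ((2 * pi / L) * (of_int k * (L / real n) - of_int j * (L / real n)))))"
proof -
  define m x where "m = 2 * pi / L" and "x = of_int j * (L / real n)"
  have basis: "trig_basis L n j =
      (\<lambda>w. \<Sum>p = - (int n div 2)..int n div 2.
         (1 / (of_nat n * end_weight n p)) * exp (\<i> * of_int p * of_real (m * (w - x))))"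
    by (simp add: fun_eq_iff trig_basis_def m_def x_def sum_distrib_left)
  show ?thesis
    unfolding diff2_matrix_def basis
      vector_derivative_at[OF trig_sum_has_vector_derivative] m_def[symmetric] x_def[symmetric]
    by (intro sum.cong refl) (simp add: power2_eq_square algebra_simps)
qed

text \<open>
  The second derivative multiplies the mode \<open>p\<close> by the real number \<open>- (p * \<mu>)\<^sup>2\<close> with
  \<open>\<mu> = 2 * pi / L\<close>, and conjugating \<open>exp (\<i> * p * \<mu> * (x\<^sub>k - x\<^sub>j))\<close> exchanges the two nodes.
  Hermitian symmetry thus holds mode by mode.
\<close>

lemma cnj_diff2_matrix: "cnj (diff2_matrix L n k j) = diff2_matrix L n j k"
proof -
  have "cnj (end_weight n p) = end_weight n p" for p
    by (simp add: end_weight_def)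
  then show ?thesis
    unfolding diff2_matrix_eq cnj_sum
    by (intro sum.cong refl) (simp add: exp_cnj algebra_simps)
qed

text \<open>
  The form pairs each grid point with the points of the grid line through it in direction \<open>r\<close>.
  Exchanging the two points of a pair is the involution \<open>(j, k) \<mapsto> (set_index j r k, j $ r)\<close>, under
  which a Hermitian kernel turns the form into its conjugate.
\<close>

lemma hermitian_line_form_real:
  assumes herm: "\<And>k m. cnj (D k m) = D m k"
  shows "Im (\<Sum>j\<in>grid_index N. (\<Sum>k = 0..int (N $ r) - 1. D (j $ r) k * A (set_index j r k))
             * cnj (A j)) = 0"
    (is "Im ?F = 0")
proof -
  let ?P = "grid_index N \<times> {0..int (N $ r) - 1}"
  let ?s = "\<lambda>(j, k). (set_index j r k, j $ r)"
  have "?F = (\<Sum>(j, k)\<in>?P. D (j $ r) k * A (set_index j r k) * cnj (A j))"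
    by (simp add: sum_distrib_right sum.cartesian_product)
  also have "\<dots> = (\<Sum>(j, k)\<in>?P. cnj (D (j $ r) k * A (set_index j r k) * cnj (A j)))"
  proof (rule sum.reindex_bij_witness[of _ ?s ?s], goal_cases)
    case (1 a)
    then show ?case
      by (auto simp: set_index_def vec_eq_iff)
  next
    case (2 a)
    then show ?case
      by (auto simp: set_index_def grid_index_def)
  next
    case (3 a)
    then show ?case
      by (auto simp: set_index_def vec_eq_iff)
  next
    case (4 a)
    then show ?case
      by (auto simp: set_index_def grid_index_def)
  next
    case (5 a)
    obtain j k where a: "a = (j, k)"
      by (cases a)
    have "set_index (set_index j r k) r (j $ r) = j" "set_index j r k $ r = k"
      by (auto simp: set_index_def vec_eq_iff)
    then show ?case
      by (simp add: a herm)
  qed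
  also have "\<dots> = cnj ?F"
    by (simp add: sum_distrib_right sum.cartesian_product split_def)
  finally have "?F = cnj ?F" .
  moreover have "Im z = 0" if "z = cnj z" for z
    using arg_cong[OF that, of Im] by simp
  ultimately show ?thesis
    by blast
qed

lemma laplacian_h_quadratic_form_real:
  "Im (\<Sum>j\<in>grid_index N. laplacian_h l N A j * cnj (A j)) = 0"
proof -
  have "(\<Sum>j\<in>grid_index N. laplacian_h l N A j * cnj (A j)) =
    (\<Sum>r\<in>UNIV. \<Sum>j\<in>grid_index N.
       (\<Sum>k = 0..int (N $ r) - 1. diff2_matrix (l $ r) (N $ r) (j $ r) k * A (set_index j r k))
       * cnj (A j))"
    unfolding laplacian_h_def sum_distrib_right[of _ UNIV] by (rule sum.swap)
  also have "Im \<dots> = 0"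
    unfolding Im_sum[of _ UNIV]
    by (intro sum.neutral ballI hermitian_line_form_real cnj_diff2_matrix)
  finally show ?thesis .
qed

lemma crank_nicolson_step_mass:
  fixes c :: real and q :: "int ^ 3 \<Rightarrow> real"
  assumes "c \<noteq> 0"
    and A: "\<And>j. A j = (V j + W j) / 2"
    and step: "\<And>j. j \<in> grid_index N \<Longrightarrow>
      \<i> * ((V j - W j) / of_real c) + laplacian_h l N A j + of_real (q j) * A j = 0"
  shows "mass_h l N V = mass_h l N W"
proof -
  have "(Re (V j * cnj (V j)) - Re (W j * cnj (W j))) / (2 * c)
      + Im (laplacian_h l N A j * cnj (A j)) = 0" if "j \<in> grid_index N" for j
  proof -
    have "(\<i> * ((V j - W j) / of_real c) + laplacian_h l N A j + of_real (q j) * A j)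
        * cnj (A j) = 0"
      using step[OF that] by simp
    then have "Im (\<i> * ((V j - W j) / of_real c) * cnj (A j))
        + Im (laplacian_h l N A j * cnj (A j)) + Im (of_real (q j) * A j * cnj (A j)) = 0"
      by (metis distrib_right plus_complex.sel(2) zero_complex.sel(2))
    \<comment> \<open>The cross terms \<open>V * cnj W - W * cnj V\<close> are purely imaginary and drop out; the factor 2 comes
      from the average.\<close>
    moreover have "Im (\<i> * ((V j - W j) / of_real c) * cnj (A j)) =
        (Re (V j * cnj (V j)) - Re (W j * cnj (W j))) / (2 * c)"
      using \<open>c \<noteq> 0\<close> by (simp add: A field_simps)
    moreover have "Im (of_real (q j) * A j * cnj (A j)) = 0"
      by simp
    ultimately show ?thesis
      by simp
  qed
  then have "(\<Sum>j\<in>grid_index N. (Re (V j * cnj (V j)) - Re (W j * cnj (W j))) / (2 * c)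
      + Im (laplacian_h l N A j * cnj (A j))) = 0"
    by (rule sum.neutral[OF ballI])
  moreover have "(\<Sum>j\<in>grid_index N. Im (laplacian_h l N A j * cnj (A j))) = 0"
    using laplacian_h_quadratic_form_real[of l N A] by (simp only: Im_sum)
  ultimately have "(\<Sum>j\<in>grid_index N. Re (V j * cnj (V j)))
      - (\<Sum>j\<in>grid_index N. Re (W j * cnj (W j))) = 0"
    using \<open>c \<noteq> 0\<close>
    by (simp only: sum.distrib sum_subtractf flip: sum_divide_distrib) simp
  then have "Re (inner_h l N V V) = Re (inner_h l N W W)"
    by (simp only: inner_h_def Re_sum Re_complex_of_real Im_complex_of_real times_complex.sel) simp
  then show ?thesis
    by (simp add: mass_h_def norm_h_def)
qed

theorem theorem2p1:
  fixes l :: "real ^ 3" and N :: "nat ^ 3"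
    and T \<tau> \<beta> \<gamma> :: real and M :: nat
    and \<psi>0 :: "real ^ 3 \<Rightarrow> complex"
    and U :: "nat \<Rightarrow> grid_fun"
  assumes "\<And>r. l $ r > 0"
    and "\<And>r. N $ r > 0" and "\<And>r. even (N $ r)"
    and "T > 0" and "M > 0" and "\<tau> = T / real M"
    and "\<gamma> > 0"
    and "box_periodic l \<psi>0"
    and "\<And>j. j \<in> grid_index N \<Longrightarrow> laplacian_exists_at \<psi>0 (grid_point l N j)"
    and "\<And>n. n \<le> M \<Longrightarrow> U n \<in> grid_space N"
    and "\<And>j. j \<in> grid_index N \<Longrightarrow> U 0 j = \<psi>0 (grid_point l N j)"
    and scheme: "\<And>n j. n \<in> {1..M - 1} \<Longrightarrow> j \<in> grid_index N \<Longrightarrow>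
        \<i> * dt_central \<tau> U n j + laplacian_h l N (avg_hat U n) j
          + of_real (\<beta> * exp (- 2 * \<gamma> * (real n * \<tau>)) * (cmod (U n j))\<^sup>2) * avg_hat U n j = 0"
    and first_step: "\<And>j. j \<in> grid_index N \<Longrightarrow>
        \<i> * dt_forward \<tau> U 0 j + laplacian_h l N (avg_half U 0) j
          + of_real (\<beta> * exp (- 2 * \<gamma> * (\<tau> / 2)) * (cmod (half_step_data l N \<beta> \<tau> \<psi>0 j))\<^sup>2)
            * avg_half U 0 j = 0"
  shows "\<forall>n\<in>{1..M}. mass_h l N (U n) = mass_h l N (U 0)"
proof -
  have "\<tau> \<noteq> 0"
    using \<open>T > 0\<close> \<open>M > 0\<close> \<open>\<tau> = T / real M\<close> by simp
  have start: "mass_h l N (U 1) = mass_h l N (U 0)"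
  proof (rule crank_nicolson_step_mass)
    show "\<tau> \<noteq> 0"
      by fact
    show "avg_half U 0 j = (U 1 j + U 0 j) / 2" for j
      by (simp add: avg_half_def)
    show "\<i> * ((U 1 j - U 0 j) / of_real \<tau>) + laplacian_h l N (avg_half U 0) j
        + of_real (\<beta> * exp (- 2 * \<gamma> * (\<tau> / 2)) * (cmod (half_step_data l N \<beta> \<tau> \<psi>0 j))\<^sup>2)
          * avg_half U 0 j = 0"
      if "j \<in> grid_index N" for j
      using first_step[OF that] by (simp only: dt_forward_def add_0)
  qed
  have leapfrog: "mass_h l N (U (n + 1)) = mass_h l N (U (n - 1))" if "n \<in> {1..M - 1}" for n
  proof (rule crank_nicolson_step_mass)
    show "2 * \<tau> \<noteq> 0"
      using \<open>\<tau> \<noteq> 0\<close> by simp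
    show "avg_hat U n j = (U (n + 1) j + U (n - 1) j) / 2" for j
      by (simp only: avg_hat_def)
    show "\<i> * ((U (n + 1) j - U (n - 1) j) / of_real (2 * \<tau>)) + laplacian_h l N (avg_hat U n) j
        + of_real (\<beta> * exp (- 2 * \<gamma> * (real n * \<tau>)) * (cmod (U n j))\<^sup>2) * avg_hat U n j = 0"
      if "j \<in> grid_index N" for j
      using scheme[OF \<open>n \<in> {1..M - 1}\<close> that] by (simp only: dt_central_def)
  qed
  have "mass_h l N (U n) = mass_h l N (U 0)" if "n \<le> M" for n
    using that
  proof (induction n rule: less_induct)
    case (less n)
    consider "n = 0" | "n = 1" | "n \<ge> 2"
      by linarith
    then show ?case
    proof cases
      case 3
      then obtain k where "n = 2 + k"
        using le_Suc_ex by blast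
      then show ?thesis
        using leapfrog[of "k + 1"] less.IH[of k] less.prems by (simp add: add.commute)
    qed (use start in auto)
  qed
  then show ?thesis
    by (meson atLeastAtMost_iff)
qed

end
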